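(* Let $n\ge1$ be a natural number. Define the double-indexed sequence $H_r(k)$ for integers $r,k\ge0$ by $H_r(0)=1$ for all $r$, and for $k\ge1$ $$H_r(k)=(n-r-k)\,H_r(k-1)+2\,(n-2r-\delta(n-1))\,H_{r+1}(k-1).$$ Then $$L(n)=\frac{H_0(\lfloor n/2\rfloor)}{(n-1)(n-2)\cdots(n-\lfloor n/2\rfloor)},$$ where $L$ is the Lucas sequence.
   Context: For a natural number $m$, $\delta(m)\in\{0,1\}$ denotes $m\bmod 2$. Empty products equal $1$. The Lucas sequence is defined by $L(0)=2$, $L(1)=1$, $L(m+1)=L(m)+L(m-1)$. *)

theory Defs
  imports Complex_Main
begin

definition parity_bit :: "nat \<Rightarrow> nat" where
  "parity_bit m = m mod 2"

fun lucas :: "nat \<Rightarrow> nat" where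
  "lucas 0 = 2"
| "lucas (Suc 0) = 1"
| "lucas (Suc (Suc m)) = lucas (Suc m) + lucas m"

(* H n r k is H_r(k) for the fixed n.  The values are integers because the
   coefficients n - r - k and n - 2 r - delta (n - 1) can be negative.
   The argument n - 1 of the parity bit is truncated, so it is only the intended one for n >= 1. *)
fun H :: "nat \<Rightarrow> nat \<Rightarrow> nat \<Rightarrow> int" where
  "H n r 0 = 1"
| "H n r (Suc k) =
     (int n - int r - int (Suc k)) * H n r k
     + 2 * (int n - 2 * int r - int (parity_bit (n - 1))) * H n (Suc r) k"

end

theory Submission
  imports Defs "HOL-Number_Theory.Fib"
begin

text \<open>Unfold the recursion along lattice paths. A step that keeps \<open>r\<close> has weight \<open>n - (r + k)\<close>,
  and \<open>r + k\<close> is changed only by such steps, so the weight of a path depends only on the number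
  \<open>j\<close> of steps that raise \<open>r\<close>. Hence \<open>H n r k\<close> is a sum over \<open>j\<close> of \<open>k choose j\<close> times two
  products of linear factors. For \<open>r = 0\<close> and \<open>k = n div 2\<close>, the even numbers in \<open>2 ^ j * (k choose j)\<close>
  interlace with the weights of the raising steps to form \<open>n! / (j! * (n - 2 * j)!)\<close>, and
  division by the denominator leaves the \<open>j\<close>-th term \<open>n / (n - j) * (n - j choose j)\<close>
  of the classical formula for \<open>L(n)\<close>.\<close>

text \<open>Pascal's rule in the shape of the recursion of \<open>H\<close>: one sum for the branch
  that keeps \<open>r\<close>, one for the branch that raises it.\<close>

lemma sum_choose_pascal:
  fixes g :: "nat \<Rightarrow> 'a::comm_semiring_1"
  shows "(\<Sum>j\<le>Suc k. of_nat (Suc k choose j) * g j)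
    = (\<Sum>j\<le>k. of_nat (k choose j) * g j) + (\<Sum>j\<le>k. of_nat (k choose j) * g (Suc j))"
proof -
  have "(\<Sum>j\<le>Suc k. of_nat (Suc k choose j) * g j)
      = g 0 + (\<Sum>j\<le>k. of_nat (k choose Suc j) * g (Suc j)) + (\<Sum>j\<le>k. of_nat (k choose j) * g (Suc j))"
    by (subst sum.atMost_Suc_shift) (simp add: algebra_simps sum.distrib del: sum.atMost_Suc)
  also have "g 0 + (\<Sum>j\<le>k. of_nat (k choose Suc j) * g (Suc j)) = (\<Sum>j\<le>Suc k. of_nat (k choose j) * g j)"
    by (subst sum.atMost_Suc_shift) simp
  finally show ?thesis by (simp add: binomial_eq_0)
qed

lemma H_closed_form:
  "H n r k = (\<Sum>j\<le>k. of_nat (k choose j)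
     * ((\<Prod>i<j. 2 * (int n - 2 * int (r + i) - int (parity_bit (n - 1))))
        * (\<Prod>i<k - j. int n - int r - int k + int i)))"
proof (induction k arbitrary: r)
  case (Suc k)
  define b where "b r = 2 * (int n - 2 * int r - int (parity_bit (n - 1)))" for r
  \<comment> \<open>Prepending a step to a path adds the factor at \<open>i = 0\<close>: in the
    second product if the step keeps \<open>r\<close>, in the first product if it raises
    \<open>r\<close>.\<close>
  define g where "g j = (\<Prod>i<j. b (r + i)) * (\<Prod>i<Suc k - j. int n - int r - int (Suc k) + int i)" for j
  have keep: "(int n - int r - int (Suc k)) * H n r k = (\<Sum>j\<le>k. of_nat (k choose j) * g j)"
    unfolding Suc.IH sum_distrib_left
  proof (rule sum.cong)
    fix j assume "j \<in> {..k}"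
    then show "(int n - int r - int (Suc k)) * (of_nat (k choose j)
       * ((\<Prod>i<j. 2 * (int n - 2 * int (r + i) - int (parity_bit (n - 1))))
        * (\<Prod>i<k - j. int n - int r - int k + int i))) = of_nat (k choose j) * g j"
      by (simp add: g_def b_def Suc_diff_le prod.lessThan_Suc_shift algebra_simps del: prod.lessThan_Suc)
  qed simp
  have raise: "b r * H n (Suc r) k = (\<Sum>j\<le>k. of_nat (k choose j) * g (Suc j))"
    unfolding Suc.IH sum_distrib_left
    by (rule sum.cong)
      (simp_all add: g_def b_def prod.lessThan_Suc_shift algebra_simps del: prod.lessThan_Suc)
  have "H n r (Suc k) = (\<Sum>j\<le>Suc k. of_nat (Suc k choose j) * g j)"
    using keep raise by (simp add: sum_choose_pascal b_def del: sum.atMost_Suc)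
  then show ?case by (simp add: g_def b_def)
qed simp

lemma choose_prod_eq_fact:
  assumes "2 * j \<le> n"
  shows "real (n div 2 choose j) * (\<Prod>i<j. 2 * (real n - 2 * real i - real (parity_bit (n - 1))))
      * (fact j * fact (n - 2 * j)) = fact n"
  using assms
proof (induction j)
  case (Suc j)
  define m where "m = n div 2"
  define c where "c = real (m choose j)"
  define d where "d = real n - 2 * real j - real (parity_bit (n - 1))"
  define P where "P = (\<Prod>i<j. 2 * (real n - 2 * real i - real (parity_bit (n - 1))))"
  have "j \<le> m" using Suc.prems by (simp add: m_def)
  have "Suc j * (m choose Suc j) = (m - j) * (m choose j)"
    using binomial_absorb_comp[of m j] binomial_absorption[of j m] by simp
  then have absorb: "real (Suc j) * real (m choose Suc j) = (real m - real j) * c"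
    unfolding c_def using \<open>j \<le> m\<close> by (metis of_nat_mult of_nat_diff)
  \<comment> \<open>Of the consecutive numbers \<open>n - 2 * j\<close> and
    \<open>n - 2 * j - 1\<close>, the even one is \<open>2 * (m - j)\<close> and the odd one is
    \<open>d\<close>.\<close>
  have pair: "2 * (real m - real j) * d = (real n - 2 * real j) * (real n - 2 * real j - 1)"
  proof (cases "even n")
    case True
    \<comment> \<open>The premise forces \<open>n\<close> to be positive; at \<open>n = 0\<close>
      truncation would make the bit 0.\<close>
    then have "real n = 2 * real m" "parity_bit (n - 1) = 1"
      using Suc.prems by (auto simp: m_def parity_bit_def elim!: evenE) presburger
    then show ?thesis by (simp add: d_def algebra_simps)
  next
    case False
    then have "real n = 2 * real m + 1" "parity_bit (n - 1) = 0"
      by (auto simp: m_def parity_bit_def elim!: oddE)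
    then show ?thesis by (simp add: d_def algebra_simps)
  qed
  have split: "n - 2 * j = Suc (Suc (n - 2 * Suc j))" using Suc.prems by simp
  have "(fact (n - 2 * j) :: real)
      = (real n - 2 * real j) * (real n - 2 * real j - 1) * fact (n - 2 * Suc j)"
    unfolding split fact_Suc using Suc.prems by (simp add: of_nat_diff algebra_simps)
  then have fact: "(fact (n - 2 * j) :: real) = 2 * (real m - real j) * d * fact (n - 2 * Suc j)"
    using pair by simp
  have "real (m choose Suc j) * (P * (2 * d)) * (fact (Suc j) * fact (n - 2 * Suc j))
      = (real (Suc j) * real (m choose Suc j)) * (P * (2 * d)) * (fact j * fact (n - 2 * Suc j))"
    by (simp add: algebra_simps)
  also have "\<dots> = c * P * (fact j * fact (n - 2 * j))"
    unfolding absorb fact by (simp add: algebra_simps)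
  also have "\<dots> = fact n"
    using Suc by (simp add: c_def P_def m_def)
  finally show ?case by (simp add: P_def d_def m_def)
qed simp

lemma prod_diff_mult_fact:
  assumes "j < n"
  shows "(\<Prod>i = 1..j. real n - real i) * fact (n - 1 - j) = fact (n - 1)"
  using assms
proof (induction j)
  case (Suc j)
  have "n - 1 - j = Suc (n - 1 - Suc j)" using Suc.prems by simp
  then have "(fact (n - 1 - j) :: real) = real (Suc (n - 1 - Suc j)) * fact (n - 1 - Suc j)"
    by (metis fact_Suc)
  also have "real (Suc (n - 1 - Suc j)) = real n - real (Suc j)"
    using Suc.prems by (simp add: of_nat_diff)
  finally show ?case using Suc by (simp add: mult.assoc)
qed simp

lemma lucas_eq_fib: "lucas (Suc p) = fib (Suc (Suc p)) + fib p"
  by (induction p rule: fib.induct) simp_all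

text \<open>The number \<open>n / (n - j) * (n - j choose j)\<close> without division. For
  \<open>n\<close> \<ge> 3 it counts sets of \<open>j\<close> disjoint edges in an
  \<open>n\<close>-cycle: first those avoiding a fixed edge, then those using it. Without the case
  split, truncation would add a spurious 1 at \<open>j = 0\<close>.\<close>

definition lucas_term :: "nat \<Rightarrow> nat \<Rightarrow> nat" where
  "lucas_term n j = (n - j choose j) + (if j = 0 then 0 else n - 1 - j choose (j - 1))"

text \<open>With denominators cleared, the two binomials contribute \<open>n - j\<close> and
  \<open>j\<close> copies of \<open>fact (n - 1 - j)\<close>.\<close>

lemma lucas_term_fact:
  assumes "n \<ge> 1" "2 * j \<le> n"
  shows "lucas_term n j * (fact j * fact (n - 2 * j)) = n * fact (n - 1 - j)"
proof (cases j)
  case 0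
  then show ?thesis using assms by (simp add: lucas_term_def fact_reduce[of n])
next
  case (Suc i)
  have first: "fact j * fact (n - 2 * j) * (n - j choose j) = fact (n - j)"
    using binomial_fact_lemma[of j "n - j"] assms by (simp add: mult_2)
  have "fact i * fact (n - 2 * j) * (n - 1 - j choose i) = fact (n - 1 - j)"
    using binomial_fact_lemma[of i "n - 1 - j"] assms Suc by (simp add: mult_2)
  then have second: "fact j * fact (n - 2 * j) * (n - 1 - j choose i) = j * fact (n - 1 - j)"
    using Suc by (simp add: algebra_simps)
  have "n - j = Suc (n - 1 - j)" using assms Suc by simp
  then have "fact (n - j) = (n - j) * fact (n - 1 - j)"
    by (metis fact_Suc of_nat_id)
  then have "lucas_term n j * (fact j * fact (n - 2 * j)) = (n - j + j) * fact (n - 1 - j)"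
    using first second Suc by (simp add: lucas_term_def algebra_simps)
  then show ?thesis using assms by simp
qed

text \<open>Diagonals of Pascal's triangle sum to Fibonacci numbers; L(n) = F(n+1) + F(n-1) adds two
  of them, the second shifted by one in \<open>j\<close>.\<close>

lemma lucas_eq_sum:
  assumes "n \<ge> 1"
  shows "lucas n = (\<Sum>j\<le>n div 2. lucas_term n j)"
proof (cases "n = 1")
  case True
  then show ?thesis by (simp add: lucas_term_def)
next
  case False
  define p where "p = n - 2"
  then have n: "n = Suc (Suc p)"
    using assms False by simp
  have "lucas n = (\<Sum>j\<le>n. n - j choose j) + (\<Sum>j\<le>p. p - j choose j)"
    unfolding n lucas_eq_fib ne_diagonal_fib[symmetric] atLeast0AtMost ..
  also have "(\<Sum>j\<le>p. p - j choose j) = (\<Sum>j\<le>n. if j = 0 then 0 else n - 1 - j choose (j - 1))"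
    unfolding n by (subst sum.atMost_Suc_shift) simp
  also have "(\<Sum>j\<le>n. n - j choose j) + \<dots> = (\<Sum>j\<le>n. lucas_term n j)"
    by (simp add: lucas_term_def sum.distrib)
  \<comment> \<open>Past \<open>n div 2\<close> the lower indices exceed the upper ones. This fails
    for \<open>n = 1\<close>, where truncation yields \<open>0 choose 0\<close> at
    \<open>j = 1\<close>.\<close>
  also have "\<dots> = (\<Sum>j\<le>n div 2. lucas_term n j)"
    by (rule sum.mono_neutral_right) (auto simp: lucas_term_def n binomial_eq_0)
  finally show ?thesis .
qed

text \<open>Reversing the tail by \<open>i\<close> to \<open>m - i\<close> gives the product over
  the steps that keep \<open>r\<close>, so it cancels from the denominator.\<close>

lemma prod_reflect_split:
  assumes "j \<le> m"
  shows "(\<Prod>i = 1..m. x - real i) = (\<Prod>i = 1..j. x - real i) * (\<Prod>i<m - j. x - real m + real i)"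
proof -
  have "(\<Prod>i<m - j. x - real m + real i) = (\<Prod>i = Suc j..m. x - real i)"
    by (rule prod.reindex_bij_witness[where i = "\<lambda>i. m - i" and j = "\<lambda>i. m - i"])
      (use assms in \<open>auto simp: of_nat_diff\<close>)
  moreover have "{1..m} = {1..j} \<union> {Suc j..m}" using assms by auto
  ultimately show ?thesis by (simp add: prod.union_disjoint)
qed

lemma summand_eq:
  assumes "n \<ge> 1" "j \<le> n div 2"
  shows "real (n div 2 choose j)
      * ((\<Prod>i<j. 2 * (real n - 2 * real i - real (parity_bit (n - 1))))
         * (\<Prod>i<n div 2 - j. real n - real (n div 2) + real i))
    = real (lucas_term n j) * (\<Prod>i = 1..n div 2. real n - real i)"
proof -
  define C where "C = real (n div 2 choose j)
      * (\<Prod>i<j. 2 * (real n - 2 * real i - real (parity_bit (n - 1))))"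
  define D where "D = (\<Prod>i = 1..j. real n - real i)"
  define F where "F = (fact j * fact (n - 2 * j) :: real)"
  have j: "2 * j \<le> n" "j < n" using assms by auto
  have "real (lucas_term n j) * F = real n * fact (n - 1 - j)"
    using arg_cong[OF lucas_term_fact[OF assms(1) j(1)], of real] by (simp add: F_def)
  \<comment> \<open>Both sides become \<open>fact n\<close> after multiplication by the nonzero
    \<open>F\<close>, which is then cancelled.\<close>
  then have "real (lucas_term n j) * D * F = real n * (D * fact (n - 1 - j))"
    by (simp add: algebra_simps)
  also have "\<dots> = fact n"
    using assms unfolding D_def prod_diff_mult_fact[OF j(2)] by (simp add: fact_reduce[of n])
  also have "\<dots> = C * F"
    using choose_prod_eq_fact[OF j(1)] by (simp add: C_def F_def)
  finally have "C = real (lucas_term n j) * D" by (simp add: F_def)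
  then show ?thesis
    unfolding prod_reflect_split[OF assms(2)] by (simp add: C_def D_def algebra_simps)
qed

theorem theorem16:
  fixes n :: nat
  assumes "n \<ge> 1"
  shows "real (lucas n) = real_of_int (H n 0 (n div 2)) / (\<Prod>i = 1..n div 2. real n - real i)"
proof -
  define D where "D = (\<Prod>i = 1..n div 2. real n - real i)"
  have "D \<noteq> 0" using assms by (auto simp: D_def)
  have "real_of_int (H n 0 (n div 2)) = (\<Sum>j\<le>n div 2. real (n div 2 choose j)
      * ((\<Prod>i<j. 2 * (real n - 2 * real i - real (parity_bit (n - 1))))
         * (\<Prod>i<n div 2 - j. real n - real (n div 2) + real i)))"
    unfolding H_closed_form by simp
  also have "\<dots> = (\<Sum>j\<le>n div 2. real (lucas_term n j) * D)"
    unfolding D_def by (rule sum.cong[OF refl], rule summand_eq[OF assms]) simp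
  also have "\<dots> = real (lucas n) * D"
    by (simp add: lucas_eq_sum[OF assms] sum_distrib_right)
  finally show ?thesis unfolding D_def[symmetric] using \<open>D \<noteq> 0\<close> by simp
qed

end
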